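(* Let $DSP$ denote the degree sequence polynomial of a tree (a polynomial in $x$), and write $DSP(n)=DSP(\tau(n))$, where $\tau(n)$ is the rooted tree with Matula number $n$. Then for every positive integer $n$, $$DSP(n)=\begin{cases}1, & \text{if } n=1;\\ DSP(t)+x^{\Omega(t)}(x-1)+x, & \text{if } n=p_t \text{ with } t\ge 1;\\ DSP(r)+DSP(s)-x^{\Omega(r)}-x^{\Omega(s)}+x^{\Omega(n)}, & \text{if } n=rs \text{ with } r,s\ge 2.\end{cases}$$
   Context: For $m\ge 1$ let $p_m$ denote the $m$-th prime ($p_1=2,p_2=3,p_3=5,\dots$). For a positive integer $n$, $\Omega(n)$ is the number of prime divisors of $n$ counted with multiplicity. Rooted trees are finite and considered up to isomorphism of rooted trees. The Matula number $\mu(T)$ of a rooted tree $T$ is defined recursively: $\mu(T)=1$ for the one-vertex tree; otherwise, if $T_1,\dots,T_d$ are the subtrees rooted at the vertices adjacent to the root of $T$, then $\mu(T)=p_{\mu(T_1)}p_{\mu(T_2)}\cdots p_{\mu(T_d)}$. The map $\mu$ is a bijection from rooted trees to positive integers, and $\tau(n)$ denotes the rooted tree with Matula number $n$. Equivalently: $\tau(1)$ is the one-vertex tree; $\tau(p_t)$ is obtained from $\tau(t)$ by adding a new vertex, which becomes the root, joined by an edge to the root of $\tau(t)$; and, for $r,s\ge 2$, $\tau(rs)$ is obtained from $\tau(r)$ and $\tau(s)$ by identifying their roots. For a statistic $S$ on rooted trees, $S(n)$ means $S(\tau(n))$. The degree $\deg(i)$ of a vertex $i$ is the number of edges incident with $i$.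 The degree sequence polynomial of a graph is $\sum_i x^{\deg(i)}$, the sum being over all vertices $i$. *)

theory Defs
  imports
    "HOL-Library.Infinite_Set"
    "HOL-Computational_Algebra.Computational_Algebra"
begin

definition nth_prime :: "nat \<Rightarrow> nat" where
  "nth_prime m = enumerate {p::nat. prime p} (m - 1)"
  (* enumerate counts from 0, whereas p_1 = 2; only m \<ge> 1 is meaningful *)

definition Omega :: "nat \<Rightarrow> nat" where
  "Omega n = size (prime_factorization n)"

record 'a rooted_graph =
  verts :: "'a set"
  edges :: "'a set set"
  root_vertex :: 'a

definition finite_simple_graph :: "'a rooted_graph \<Rightarrow> bool" where
  "finite_simple_graph G \<longleftrightarrow>
     finite (verts G) \<and> (\<forall>e\<in>edges G. e \<subseteq> verts G \<and> card e = 2)"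

definition adj :: "'a set set \<Rightarrow> 'a rel" where
  "adj E = {(u, v). {u, v} \<in> E}"

definition is_connected :: "'a rooted_graph \<Rightarrow> bool" where
  "is_connected G \<longleftrightarrow> (\<forall>u\<in>verts G. \<forall>v\<in>verts G. (u, v) \<in> (adj (edges G))\<^sup>*)"

definition is_cycle :: "'a rooted_graph \<Rightarrow> 'a list \<Rightarrow> bool" where
  "is_cycle G c \<longleftrightarrow> 3 \<le> length c \<and> distinct c \<and>
     successively (\<lambda>u v. {u, v} \<in> edges G) c \<and> {last c, hd c} \<in> edges G"

definition is_rooted_tree :: "'a rooted_graph \<Rightarrow> bool" where
  "is_rooted_tree G \<longleftrightarrow> finite_simple_graph G \<and> root_vertex G \<in> verts G \<and>
     is_connected G \<and> (\<nexists>c. is_cycle G c)"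

definition deg :: "'a rooted_graph \<Rightarrow> 'a \<Rightarrow> nat" where
  "deg G v = card {e \<in> edges G. v \<in> e}"

abbreviation X :: "int poly" where
  "X \<equiv> monom 1 1"

definition degree_seq_poly :: "'a rooted_graph \<Rightarrow> int poly" where
  "degree_seq_poly G = (\<Sum>v\<in>verts G. X ^ deg G v)"

definition root_neighbours :: "'a rooted_graph \<Rightarrow> 'a set" where
  "root_neighbours G = {v. {root_vertex G, v} \<in> edges G}"

(* For a neighbour v of the root: the connected component of v after deletion of the root,
   i.e. the subtree of G rooted at v. *)
definition branch_verts :: "'a rooted_graph \<Rightarrow> 'a \<Rightarrow> 'a set" where
  "branch_verts G v = {w. (v, w) \<in> (adj {e \<in> edges G. root_vertex G \<notin> e})\<^sup>*}"

definition branch :: "'a rooted_graph \<Rightarrow> 'a \<Rightarrow> 'a rooted_graph" where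
  "branch G v = \<lparr>verts = branch_verts G v,
     edges = {e \<in> edges G. e \<subseteq> branch_verts G v}, root_vertex = v\<rparr>"

lemma branch_simps [simp]:
  "verts (branch G v) = branch_verts G v"
  "edges (branch G v) = {e \<in> edges G. e \<subseteq> branch_verts G v}"
  "root_vertex (branch G v) = v"
  by (simp_all add: branch_def)

lemma root_neighboursD:
  assumes "finite_simple_graph G" "v \<in> root_neighbours G"
  shows "v \<in> verts G" "v \<noteq> root_vertex G"
  using assms by (auto simp: finite_simple_graph_def root_neighbours_def)

lemma branch_verts_subset:
  assumes "finite_simple_graph G" "v \<in> root_neighbours G"
  shows "branch_verts G v \<subseteq> verts G - {root_vertex G}"
proof
  fix w assume "w \<in> branch_verts G v"
  then have "(v, w) \<in> (adj {e \<in> edges G. root_vertex G \<notin> e})\<^sup>*"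
    by (simp add: branch_verts_def)
  then show "w \<in> verts G - {root_vertex G}"
    by (induction rule: rtrancl_induct)
      (use root_neighboursD[OF assms] assms(1) in
        \<open>auto simp: adj_def finite_simple_graph_def\<close>)
qed

lemma card_branch_verts_less:
  assumes "is_rooted_tree G" "v \<in> root_neighbours G"
  shows "card (branch_verts G v) < card (verts G)"
proof (rule psubset_card_mono)
  show "finite (verts G)"
    using assms by (simp add: is_rooted_tree_def finite_simple_graph_def)
  show "branch_verts G v \<subset> verts G"
    using branch_verts_subset[of G v] assms by (auto simp: is_rooted_tree_def)
qed

(* For the one-vertex tree the product is empty, so its Matula number is 1. *)
function matula_graph :: "'a rooted_graph \<Rightarrow> nat" where
  "matula_graph G =
     (if is_rooted_tree G
      then \<Prod>v\<in>root_neighbours G. nth_prime (matula_graph (branch G v))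
      else 0)"
  by auto
termination
  by (relation "measure (\<lambda>G. card (verts G))") (auto simp: card_branch_verts_less)

declare matula_graph.simps [simp del]

(* The value 0 above is never used in the recursion. *)
lemma is_rooted_tree_branch:
  assumes G: "is_rooted_tree G" and v: "v \<in> root_neighbours G"
  shows "is_rooted_tree (branch G v)"
proof -
  let ?R = "adj {e \<in> edges G. root_vertex G \<notin> e}"
  let ?W = "branch_verts G v"
  let ?S = "adj {e \<in> edges G. e \<subseteq> ?W}"
  have fsg: "finite_simple_graph G"
    using G by (simp add: is_rooted_tree_def)
  have sub: "?W \<subseteq> verts G - {root_vertex G}"
    using branch_verts_subset[OF fsg v] .
  have vW: "v \<in> ?W"
    by (simp add: branch_verts_def)
  have reach: "(v, w) \<in> ?S\<^sup>*" if "(v, w) \<in> ?R\<^sup>*" for w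
    using that
  proof (induction rule: rtrancl_induct)
    case (step y z)
    have "y \<in> ?W" "z \<in> ?W"
      using step.hyps by (auto simp: branch_verts_def intro: rtrancl.rtrancl_into_rtrancl)
    then have "(y, z) \<in> ?S"
      using step.hyps by (auto simp: adj_def)
    with step.IH show ?case
      by (rule rtrancl.rtrancl_into_rtrancl)
  qed simp
  have "sym ?S"
    by (auto simp: sym_def adj_def insert_commute)
  then have symS: "sym (?S\<^sup>*)"
    by (rule sym_rtrancl)
  have "is_connected (branch G v)"
    unfolding is_connected_def
  proof (intro ballI)
    fix a b assume "a \<in> verts (branch G v)" "b \<in> verts (branch G v)"
    then have "(v, a) \<in> ?S\<^sup>*" "(v, b) \<in> ?S\<^sup>*"
      using reach by (auto simp: branch_verts_def)
    then show "(a, b) \<in> (adj (edges (branch G v)))\<^sup>*"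
      using symS by (auto dest: symD intro: rtrancl_trans)
  qed
  moreover have "finite_simple_graph (branch G v)"
    using fsg sub by (auto simp: finite_simple_graph_def intro: finite_subset)
  moreover have "is_cycle G c" if "is_cycle (branch G v) c" for c
    using that unfolding is_cycle_def by (auto intro: successively_mono)
  ultimately show ?thesis
    using G vW by (auto simp: is_rooted_tree_def)
qed

definition iso_map :: "('a \<Rightarrow> 'b) \<Rightarrow> 'a rooted_graph \<Rightarrow> 'b rooted_graph \<Rightarrow> bool" where
  "iso_map f G H \<longleftrightarrow> bij_betw f (verts G) (verts H) \<and>
     edges H = (\<lambda>e. f ` e) ` edges G \<and> f (root_vertex G) = root_vertex H"

definition tree_iso :: "'a rooted_graph \<Rightarrow> 'b rooted_graph \<Rightarrow> bool" where
  "tree_iso G H \<longleftrightarrow> is_rooted_tree G \<and> is_rooted_tree H \<and> (\<exists>f. iso_map f G H)"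

lemma tree_iso_refl: "is_rooted_tree G \<Longrightarrow> tree_iso G G"
  unfolding tree_iso_def iso_map_def by (auto intro!: exI[of _ id])

lemma iso_map_inv:
  assumes "iso_map f G H" "is_rooted_tree G"
  shows "iso_map (inv_into (verts G) f) H G"
proof -
  have b: "bij_betw f (verts G) (verts H)"
    using assms(1) by (simp add: iso_map_def)
  then have inj: "inj_on f (verts G)"
    by (simp add: bij_betw_def)
  have "inv_into (verts G) f ` (f ` e) = e" if "e \<in> edges G" for e
    using that assms(2) inj
    by (intro inv_into_image_cancel) (auto simp: is_rooted_tree_def finite_simple_graph_def)
  then have "(\<lambda>e. inv_into (verts G) f ` e) ` edges H = edges G"
    using assms(1) by (simp add: iso_map_def image_image cong: image_cong_simp)
  moreover have "inv_into (verts G) f (root_vertex H) = root_vertex G"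
    using assms inj by (metis inv_into_f_f is_rooted_tree_def iso_map_def)
  ultimately show ?thesis
    using bij_betw_inv_into[OF b] by (simp add: iso_map_def)
qed

lemma tree_iso_sym: "tree_iso G H \<Longrightarrow> tree_iso H G"
  unfolding tree_iso_def using iso_map_inv by blast

lemma iso_map_comp:
  assumes "iso_map f G H" "iso_map g H K"
  shows "iso_map (g \<circ> f) G K"
  using assms bij_betw_trans[of f "verts G" "verts H" g "verts K"]
  by (simp add: iso_map_def image_image o_def)

lemma tree_iso_trans: "tree_iso G H \<Longrightarrow> tree_iso H K \<Longrightarrow> tree_iso G K"
  unfolding tree_iso_def using iso_map_comp by blast

lemma iso_map_reach:
  assumes f: "iso_map f G H" and G: "is_rooted_tree G"
    and vw: "(v, w) \<in> (adj {e \<in> edges G. root_vertex G \<notin> e})\<^sup>*"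
  shows "(f v, f w) \<in> (adj {e \<in> edges H. root_vertex H \<notin> e})\<^sup>*"
  using vw
proof (induction rule: rtrancl_induct)
  case (step y z)
  have e: "{y, z} \<in> edges G" "root_vertex G \<notin> {y, z}"
    using step.hyps by (auto simp: adj_def)
  then have "{y, z} \<subseteq> verts G" "root_vertex G \<in> verts G"
    using G by (auto simp: is_rooted_tree_def finite_simple_graph_def)
  then have "root_vertex H \<notin> {f y, f z}"
    using f e by (auto simp: iso_map_def bij_betw_def inj_on_def)
  moreover have "f ` {y, z} \<in> edges H"
    using f e unfolding iso_map_def by blast
  then have "{f y, f z} \<in> edges H"
    by simp
  ultimately have "(f y, f z) \<in> adj {e \<in> edges H. root_vertex H \<notin> e}"
    by (auto simp: adj_def)
  with step.IH show ?case
    by (rule rtrancl.rtrancl_into_rtrancl)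
qed simp

lemma iso_map_root_neighbours:
  assumes f: "iso_map f G H"
    and v: "v \<in> root_neighbours G"
  shows "f v \<in> root_neighbours H"
proof -
  have "f ` {root_vertex G, v} \<in> edges H"
    using f v unfolding iso_map_def root_neighbours_def by blast
  then show ?thesis
    using f by (simp add: iso_map_def root_neighbours_def)
qed

lemma bij_betw_root_neighbours:
  assumes f: "iso_map f G H" and G: "is_rooted_tree G" and H: "is_rooted_tree H"
  shows "bij_betw f (root_neighbours G) (root_neighbours H)"
proof -
  let ?g = "inv_into (verts G) f"
  have g: "iso_map ?g H G"
    using iso_map_inv[OF f G] .
  have sG: "root_neighbours G \<subseteq> verts G" and sH: "root_neighbours H \<subseteq> verts H"
    using G H by (auto simp: is_rooted_tree_def dest: root_neighboursD)
  have b: "bij_betw f (verts G) (verts H)"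
    using f by (simp add: iso_map_def)
  show ?thesis
    by (rule bij_betw_byWitness[where f' = ?g])
      (use sG sH b iso_map_root_neighbours[OF f] iso_map_root_neighbours[OF g] in
        \<open>auto simp: bij_betw_inv_into_left bij_betw_inv_into_right subset_iff\<close>)
qed

lemma iso_map_branch:
  assumes f: "iso_map f G H" and G: "is_rooted_tree G" and H: "is_rooted_tree H"
    and v: "v \<in> root_neighbours G"
  shows "iso_map f (branch G v) (branch H (f v))"
proof -
  let ?g = "inv_into (verts G) f"
  have g: "iso_map ?g H G"
    using iso_map_inv[OF f G] .
  have b: "bij_betw f (verts G) (verts H)"
    using f by (simp add: iso_map_def)
  have vG: "v \<in> verts G"
    using G v by (auto simp: is_rooted_tree_def dest: root_neighboursD)
  have fv: "f v \<in> root_neighbours H"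
    using iso_map_root_neighbours[OF f v] .
  have subG: "branch_verts G v \<subseteq> verts G"
    using branch_verts_subset[OF _ v] G by (auto simp: is_rooted_tree_def)
  have subH: "branch_verts H (f v) \<subseteq> verts H"
    using branch_verts_subset[OF _ fv] H by (auto simp: is_rooted_tree_def)
  have inj: "inj_on f (verts G)"
    using b by (simp add: bij_betw_def)
  have gfv: "?g (f v) = v"
    using inj vG by simp
  have im: "f ` branch_verts G v = branch_verts H (f v)"
  proof
    show "f ` branch_verts G v \<subseteq> branch_verts H (f v)"
      using iso_map_reach[OF f G] by (auto simp: branch_verts_def)
    show "branch_verts H (f v) \<subseteq> f ` branch_verts G v"
    proof
      fix w assume w: "w \<in> branch_verts H (f v)"
      then have "?g w \<in> branch_verts G v"
        using iso_map_reach[OF g H, of "f v" w] gfv by (simp add: branch_verts_def)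
      moreover have "f (?g w) = w"
        using w subH b by (auto intro: bij_betw_inv_into_right)
      ultimately show "w \<in> f ` branch_verts G v"
        by (metis image_eqI)
    qed
  qed
  have "f ` e \<subseteq> f ` branch_verts G v \<longleftrightarrow> e \<subseteq> branch_verts G v" if "e \<in> edges G" for e
  proof -
    have "e \<subseteq> verts G"
      using that G by (simp add: is_rooted_tree_def finite_simple_graph_def)
    then have "f x \<in> f ` branch_verts G v \<longleftrightarrow> x \<in> branch_verts G v" if "x \<in> e" for x
      using that inj_on_image_mem_iff[OF inj _ subG] by blast
    then show ?thesis
      unfolding image_subset_iff subset_iff by blast
  qed
  then have "edges (branch H (f v)) = (\<lambda>e. f ` e) ` edges (branch G v)"
    using f unfolding iso_map_def by (auto simp: im[symmetric])
  moreover have "bij_betw f (branch_verts G v) (branch_verts H (f v))"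
    using inj_on_subset[OF inj subG] im by (simp add: bij_betw_def)
  ultimately show ?thesis
    by (simp add: iso_map_def)
qed

lemma matula_graph_iso:
  assumes "iso_map f G H" "is_rooted_tree G" "is_rooted_tree H"
  shows "matula_graph G = matula_graph H"
  using assms
proof (induction "card (verts G)" arbitrary: G H rule: less_induct)
  case less
  have IH: "matula_graph (branch G v) = matula_graph (branch H (f v))"
    if v: "v \<in> root_neighbours G" for v
  proof (rule less.hyps)
    show "card (verts (branch G v)) < card (verts G)"
      using card_branch_verts_less[OF less.prems(2) v] by simp
    show "iso_map f (branch G v) (branch H (f v))"
      using iso_map_branch[OF less.prems v] .
    show "is_rooted_tree (branch G v)"
      using is_rooted_tree_branch[OF less.prems(2) v] .
    show "is_rooted_tree (branch H (f v))"
      using is_rooted_tree_branch[OF less.prems(3)]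
        iso_map_root_neighbours[OF less.prems(1) v] by simp
  qed
  have "(\<Prod>v\<in>root_neighbours G. nth_prime (matula_graph (branch G v))) =
        (\<Prod>v\<in>root_neighbours G. nth_prime (matula_graph (branch H (f v))))"
    using IH by simp
  also have "\<dots> = (\<Prod>v\<in>root_neighbours H. nth_prime (matula_graph (branch H v)))"
    using prod.reindex_bij_betw[OF bij_betw_root_neighbours[OF less.prems]] .
  finally show ?case
    using less.prems(2,3) by (simp add: matula_graph.simps[of G] matula_graph.simps[of H])
qed

lemma deg_iso:
  assumes f: "iso_map f G H" and G: "is_rooted_tree G" and v: "v \<in> verts G"
  shows "deg H (f v) = deg G v"
proof -
  have inj: "inj_on f (verts G)"
    using f by (simp add: iso_map_def bij_betw_def)
  have sub: "e \<subseteq> verts G" if "e \<in> edges G" for e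
    using that G by (simp add: is_rooted_tree_def finite_simple_graph_def)
  have mem: "f v \<in> f ` e \<longleftrightarrow> v \<in> e" if "e \<in> edges G" for e
    using inj_on_image_mem_iff[OF inj v sub[OF that]] .
  have "{e \<in> edges H. f v \<in> e} = (\<lambda>e. f ` e) ` {e \<in> edges G. v \<in> e}"
    using f mem unfolding iso_map_def by auto
  moreover have "inj_on (\<lambda>e. f ` e) {e \<in> edges G. v \<in> e}"
    using sub by (intro inj_onI) (simp add: inj_on_image_eq_iff[OF inj])
  ultimately show ?thesis
    by (simp add: deg_def card_image)
qed

lemma degree_seq_poly_iso:
  assumes f: "iso_map f G H" and G: "is_rooted_tree G"
  shows "degree_seq_poly G = degree_seq_poly H"
proof -
  have b: "bij_betw f (verts G) (verts H)"
    using f by (simp add: iso_map_def)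
  have "degree_seq_poly G = (\<Sum>v\<in>verts G. X ^ deg H (f v))"
    unfolding degree_seq_poly_def by (intro sum.cong) (simp_all add: deg_iso[OF f G])
  also have "\<dots> = degree_seq_poly H"
    unfolding degree_seq_poly_def by (rule sum.reindex_bij_betw[OF b])
  finally show ?thesis .
qed

lemma is_rooted_tree_singleton: "is_rooted_tree \<lparr>verts = {a}, edges = {}, root_vertex = a\<rparr>"
  by (simp add: is_rooted_tree_def finite_simple_graph_def is_connected_def is_cycle_def)

(* Isomorphism classes of finite rooted trees; every class has a representative with
   natural numbers as vertices. *)
quotient_type rooted_tree = "nat rooted_graph" / partial: tree_iso
proof (rule part_equivpI)
  show "\<exists>G :: nat rooted_graph. tree_iso G G"
    by (rule exI, rule tree_iso_refl, rule is_rooted_tree_singleton)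
  show "symp (tree_iso :: nat rooted_graph \<Rightarrow> _)"
    by (rule sympI) (rule tree_iso_sym)
  show "transp (tree_iso :: nat rooted_graph \<Rightarrow> _)"
    by (rule transpI) (rule tree_iso_trans)
qed

lift_definition matula :: "rooted_tree \<Rightarrow> nat" is matula_graph
  by (auto simp: tree_iso_def intro: matula_graph_iso)

lift_definition tree_dsp :: "rooted_tree \<Rightarrow> int poly" is degree_seq_poly
  by (auto simp: tree_iso_def intro: degree_seq_poly_iso)

(* matula is a bijection onto the positive integers; tau 0 is irrelevant. *)
definition tau :: "nat \<Rightarrow> rooted_tree" where
  "tau = inv matula"

definition DSP :: "nat \<Rightarrow> int poly" where
  "DSP n = tree_dsp (tau n)"

end

theory Submission
  imports Defs "HOL-Library.Countable"
begin

text \<open>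
  Cutting a rooted tree at its root leaves one branch per neighbour of the root. Inside a branch every
  vertex keeps its degree, except that the root of the branch loses the edge to the old root.
  Hence the degree sequence polynomial of the tree is the power of \<open>X\<close> for the root, plus,
  for each branch \<open>B\<close>, the polynomial of \<open>B\<close> corrected by
  \<open>X ^ (d + 1) - X ^ d = X ^ d * (X - 1)\<close>, where \<open>d\<close> is the root degree of
  \<open>B\<close> (\<open>degree_seq_poly_branches\<close>). That branches at different neighbours share no
  vertex is where acyclicity enters.

  The Matula number is a product of one prime per branch, so its number of prime factors is the
  degree of the root, and the index of each prime recovers the Matula number of the branch.
  The branch formula therefore turns into a recursion on Matula numbers alone, \<open>dsp_rec\<close>,
  and the polynomial of any tree is \<open>dsp_rec\<close> of its Matula number
  (\<open>degree_seq_poly_eq_dsp_rec\<close>). So all trees with Matula number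
  \<open>n\<close> share one polynomial, and \<open>DSP n\<close> equals \<open>dsp_rec n\<close> as soon as some
  such tree exists. What remains is this existence
  (\<open>ex_nat_tree_matula\<close>), and the fact that \<open>dsp_rec\<close> satisfies the three equations; these
  are immediate because it is, up to the term for the root, a sum over prime factors.
\<close>

section \<open>Primes and their indices\<close>

lemma prime_nth_prime: "prime (nth_prime m)"
  using enumerate_in_set[OF primes_infinite, of "m - 1"] by (simp add: nth_prime_def)

lemma add_2_le_enumerate_primes: "s + 2 \<le> enumerate {p::nat. prime p} s"
proof (induction s)
  case 0
  have "prime (enumerate {p::nat. prime p} 0)"
    using enumerate_in_set[OF primes_infinite, of 0] by simp
  then show ?case
    by (metis add_0 prime_ge_2_nat)
next
  case (Suc s)
  then show ?case
    using enumerate_step[OF primes_infinite, of s] by linarith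
qed

lemma less_nth_prime: "1 \<le> t \<Longrightarrow> t < nth_prime t"
  using add_2_le_enumerate_primes[of "t - 1"] by (simp add: nth_prime_def)

lemma inj_on_nth_prime: "inj_on nth_prime {1..}"
proof (rule inj_onI)
  fix a b :: nat
  assume "a \<in> {1..}" "b \<in> {1..}" "nth_prime a = nth_prime b"
  moreover from this have "a - 1 = b - 1"
    using strict_mono_eq[OF strict_mono_enumerate[OF primes_infinite]]
    unfolding nth_prime_def by blast
  ultimately show "a = b" by simp
qed

definition prime_index :: "nat \<Rightarrow> nat" where
  "prime_index = inv_into {1..} nth_prime"

lemma prime_index_nth_prime [simp]: "1 \<le> t \<Longrightarrow> prime_index (nth_prime t) = t"
  unfolding prime_index_def by (rule inv_into_f_f[OF inj_on_nth_prime]) simp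

lemma prime_indexE:
  assumes "prime p"
  obtains t where "1 \<le> t" "p = nth_prime t" "prime_index p = t" "t < p"
proof -
  obtain s where "enumerate {p::nat. prime p} s = p"
    using enumerate_Ex[of "{p::nat. prime p}" p] assms primes_infinite by auto
  then have "p = nth_prime (Suc s)"
    by (simp add: nth_prime_def)
  then show ?thesis
    using that[of "Suc s"] less_nth_prime[of "Suc s"] by simp
qed

text \<open>Recursion from \<open>n\<close> to the indices of its prime factors terminates.\<close>

lemma prime_index_less:
  assumes "p \<in># prime_factorization n"
  shows "prime_index p < n"
proof -
  have "prime p" "p dvd n" "n > 0"
    using assms by (auto simp: in_prime_factors_iff)
  then show ?thesis
    by (metis prime_indexE dvd_imp_le order_less_le_trans)
qed

section \<open>The recursion on Matula numbers\<close>

text \<open>The degree sequence polynomial of a tree, read off its Matula number: the leading power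
  belongs to the root, and the summand of the prime \<open>p\<close> belongs to the branch whose Matula
  number is the index of \<open>p\<close>; the term with \<open>X - 1\<close> accounts for the edge that joins
  the branch to the root.\<close>

function dsp_rec :: "nat \<Rightarrow> int poly" where
  "dsp_rec n = X ^ Omega n +
     (\<Sum>p\<in>#prime_factorization n.
        dsp_rec (prime_index p) + X ^ Omega (prime_index p) * (X - 1))"
  by auto
termination
  by (relation "measure id") (auto intro: prime_index_less)

declare dsp_rec.simps [simp del]

lemma Omega_prime [simp]: "prime p \<Longrightarrow> Omega p = 1"
  by (simp add: Omega_def prime_factorization_prime)

lemma dsp_rec_1: "dsp_rec 1 = 1"
  by (subst dsp_rec.simps) (simp add: Omega_def)

lemma dsp_rec_nth_prime:
  assumes "1 \<le> t"
  shows "dsp_rec (nth_prime t) = dsp_rec t + X ^ Omega t * (X - 1) + X"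
  using assms
  by (simp add: dsp_rec.simps[of "nth_prime t"] prime_factorization_prime prime_nth_prime)

lemma dsp_rec_mult:
  assumes "r > 0" "s > 0"
  shows "dsp_rec (r * s) = dsp_rec r + dsp_rec s - X ^ Omega r - X ^ Omega s + X ^ Omega (r * s)"
  using assms
  by (simp add: dsp_rec.simps[of "r * s"] dsp_rec.simps[of r] dsp_rec.simps[of s]
      prime_factorization_mult)

section \<open>Branches of a rooted tree\<close>

text \<open>When the next vertex already lies on the path, the path is cut back to its occurrence.
  The last conjunct keeps the path inside whatever region is closed under the relation.\<close>

lemma rtrancl_distinct_path:
  assumes "(x, y) \<in> R\<^sup>*"
  shows "\<exists>c. c \<noteq> [] \<and> hd c = x \<and> last c = y \<and> distinct c \<and>
    successively (\<lambda>u v. (u, v) \<in> R) c \<and> set c \<subseteq> R\<^sup>* `` {x}"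
  using assms
proof (induction rule: rtrancl_induct)
  case base
  show ?case by (rule exI[of _ "[x]"]) simp
next
  case (step y z)
  then obtain c where c: "c \<noteq> []" "hd c = x" "last c = y" "distinct c"
    "successively (\<lambda>u v. (u, v) \<in> R) c" "set c \<subseteq> R\<^sup>* `` {x}"
    by blast
  show ?case
  proof (cases "z \<in> set c")
    case True
    then obtain as bs where "c = (as @ [z]) @ bs"
      using split_list[of z c] by auto
    with c have "hd (as @ [z]) = x" "distinct (as @ [z])"
      "successively (\<lambda>u v. (u, v) \<in> R) (as @ [z])" "set (as @ [z]) \<subseteq> R\<^sup>* `` {x}"
      by (auto simp: successively_append_iff hd_append)
    then show ?thesis by (intro exI[of _ "as @ [z]"]) auto
  next
    case False
    have "(x, z) \<in> R\<^sup>*" using step.hyps by (rule rtrancl.rtrancl_into_rtrancl)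
    with False c step.hyps show ?thesis
      by (intro exI[of _ "c @ [z]"]) (auto simp: successively_append_iff)
  qed
qed

lemma adj_rtrancl_sym: "(x, y) \<in> (adj E)\<^sup>* \<Longrightarrow> (y, x) \<in> (adj E)\<^sup>*"
  by (rule symD[OF sym_rtrancl]) (auto simp: sym_def adj_def insert_commute)

lemma branch_verts_self: "v \<in> branch_verts G v"
  by (simp add: branch_verts_def)

text \<open>Two neighbours of the root that are connected without passing through the root would close
  up to a cycle through the root.\<close>

lemma root_neighbour_in_branch_unique:
  assumes G: "is_rooted_tree G" and v: "v \<in> root_neighbours G" and w: "w \<in> root_neighbours G"
    and reach: "w \<in> branch_verts G v"
  shows "w = v"
proof (rule ccontr)
  assume "w \<noteq> v"
  let ?R = "adj {e \<in> edges G. root_vertex G \<notin> e}"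
  have "(v, w) \<in> ?R\<^sup>*" using reach by (simp add: branch_verts_def)
  from rtrancl_distinct_path[OF this] obtain c where
    c: "c \<noteq> []" "hd c = v" "last c = w" "distinct c"
      "successively (\<lambda>u v. (u, v) \<in> ?R) c" "set c \<subseteq> ?R\<^sup>* `` {v}"
    by blast
  have "root_vertex G \<notin> set c"
    using branch_verts_subset[OF _ v] G c(6) by (auto simp: is_rooted_tree_def branch_verts_def)
  moreover have "successively (\<lambda>u v. {u, v} \<in> edges G) c"
    by (rule successively_mono[OF c(5)]) (auto simp: adj_def)
  moreover have "3 \<le> length (root_vertex G # c)"
    using c(1-3) \<open>w \<noteq> v\<close> by (cases c; cases "tl c") auto
  ultimately have "is_cycle G (root_vertex G # c)"
    using c v w by (auto simp: is_cycle_def successively_Cons root_neighbours_def insert_commute)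
  with G show False by (auto simp: is_rooted_tree_def)
qed

lemma branch_verts_disjoint:
  assumes G: "is_rooted_tree G" and v: "v \<in> root_neighbours G" and w: "w \<in> root_neighbours G"
    and ne: "v \<noteq> w"
  shows "branch_verts G v \<inter> branch_verts G w = {}"
proof -
  have "w \<in> branch_verts G v" if "x \<in> branch_verts G v" "x \<in> branch_verts G w" for x
    using rtrancl_trans[OF _ adj_rtrancl_sym] that unfolding branch_verts_def mem_Collect_eq .
  then show ?thesis
    using root_neighbour_in_branch_unique[OF G v w] ne by blast
qed

lemma branch_verts_step:
  assumes "y \<in> branch_verts G v" "{y, z} \<in> edges G" "root_vertex G \<notin> {y, z}"
  shows "z \<in> branch_verts G v"
  using assms unfolding branch_verts_def
  by (auto simp: adj_def intro: rtrancl.rtrancl_into_rtrancl)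

lemma verts_eq_root_branches:
  assumes G: "is_rooted_tree G"
  shows "verts G = insert (root_vertex G) (\<Union>v\<in>root_neighbours G. branch_verts G v)"
proof
  show "verts G \<subseteq> insert (root_vertex G) (\<Union>v\<in>root_neighbours G. branch_verts G v)"
  proof
    fix u assume "u \<in> verts G"
    then have "(root_vertex G, u) \<in> (adj (edges G))\<^sup>*"
      using G by (auto simp: is_rooted_tree_def is_connected_def)
    then show "u \<in> insert (root_vertex G) (\<Union>v\<in>root_neighbours G. branch_verts G v)"
    proof (induction rule: rtrancl_induct)
      case (step y z)
      have yz: "{y, z} \<in> edges G" using step.hyps by (simp add: adj_def)
      show ?case
      proof (cases "y = root_vertex G \<or> z = root_vertex G")
        case True
        then show ?thesis
          using yz branch_verts_self[of z G] by (auto simp: root_neighbours_def)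
      next
        case False
        then show ?thesis
          using step.IH branch_verts_step[OF _ yz] by auto
      qed
    qed simp
  qed
  show "insert (root_vertex G) (\<Union>v\<in>root_neighbours G. branch_verts G v) \<subseteq> verts G"
    using G branch_verts_subset[of G] by (auto simp: is_rooted_tree_def)
qed

lemma deg_root:
  assumes "is_rooted_tree G"
  shows "deg G (root_vertex G) = card (root_neighbours G)"
proof -
  let ?r = "root_vertex G"
  have e2: "card e = 2" if "e \<in> edges G" for e
    using assms that by (simp add: is_rooted_tree_def finite_simple_graph_def)
  have "{e \<in> edges G. ?r \<in> e} = (\<lambda>v. {?r, v}) ` root_neighbours G"
  proof
    show "{e \<in> edges G. ?r \<in> e} \<subseteq> (\<lambda>v. {?r, v}) ` root_neighbours G"
    proof
      fix e assume "e \<in> {e \<in> edges G. ?r \<in> e}"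
      then have "e \<in> edges G" "?r \<in> e" by auto
      moreover from this obtain z where "e = {?r, z}"
        using e2[of e] by (auto simp: card_2_iff)
      ultimately show "e \<in> (\<lambda>v. {?r, v}) ` root_neighbours G"
        by (auto simp: root_neighbours_def)
    qed
  qed (auto simp: root_neighbours_def)
  moreover have "inj_on (\<lambda>v. {?r, v}) (root_neighbours G)"
    by (auto simp: inj_on_def doubleton_eq_iff)
  ultimately show ?thesis by (simp add: deg_def card_image)
qed

text \<open>A branch is a connected component of the tree without its root, so an edge can leave it only
  towards the root; only the root of the branch is adjacent to the root of the tree.\<close>

lemma edge_at_branch_vertex:
  assumes G: "is_rooted_tree G" and v: "v \<in> root_neighbours G" and w: "w \<in> branch_verts G v"
    and e: "e \<in> edges G" "w \<in> e"
  shows "e \<subseteq> branch_verts G v \<or> w = v \<and> e = {root_vertex G, v}"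
proof -
  have "card e = 2"
    using G e by (simp add: is_rooted_tree_def finite_simple_graph_def)
  then obtain z where z: "e = {w, z}"
    using e(2) by (auto simp: card_2_iff)
  have "w \<noteq> root_vertex G"
    using branch_verts_subset[OF _ v] G w by (auto simp: is_rooted_tree_def)
  show ?thesis
  proof (cases "z = root_vertex G")
    case True
    then have "w \<in> root_neighbours G"
      using e z by (simp add: root_neighbours_def insert_commute)
    then have "w = v"
      using root_neighbour_in_branch_unique[OF G v _ w] by simp
    then show ?thesis using z True by auto
  next
    case False
    then show ?thesis
      using branch_verts_step[OF w, of z] e z w \<open>w \<noteq> root_vertex G\<close> by auto
  qed
qed

lemma deg_branch:
  assumes G: "is_rooted_tree G" and v: "v \<in> root_neighbours G" and w: "w \<in> branch_verts G v"
  shows "deg G w = deg (branch G v) w + (if w = v then 1 else 0)"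
proof -
  let ?r = "root_vertex G"
  let ?A = "{e \<in> edges G. e \<subseteq> branch_verts G v \<and> w \<in> e}"
  have rB: "?r \<notin> branch_verts G v"
    using branch_verts_subset[OF _ v] G by (auto simp: is_rooted_tree_def)
  have rv: "{?r, v} \<in> edges G"
    using v by (simp add: root_neighbours_def)
  have "edges G \<subseteq> Pow (verts G)" "finite (verts G)"
    using G by (auto simp: is_rooted_tree_def finite_simple_graph_def)
  then have "finite ?A"
    by (auto intro: finite_subset)
  moreover have "{?r, v} \<notin> ?A"
    using rB by auto
  ultimately have "card (insert {?r, v} ?A) = card ?A + 1"
    by simp
  moreover have "{e \<in> edges G. w \<in> e} = (if w = v then insert {?r, v} ?A else ?A)"
    using edge_at_branch_vertex[OF G v w] rv by auto
  moreover have "deg (branch G v) w = card ?A"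
    unfolding deg_def branch_simps by (rule arg_cong[where f = card]) auto
  ultimately show ?thesis
    unfolding deg_def[of G] by (simp only: if_split) auto
qed

lemma degree_seq_poly_branches:
  assumes G: "is_rooted_tree G"
  shows "degree_seq_poly G = X ^ card (root_neighbours G) +
    (\<Sum>v\<in>root_neighbours G. degree_seq_poly (branch G v)
       + X ^ card (root_neighbours (branch G v)) * (X - 1))"
proof -
  let ?N = "root_neighbours G"
  have fin: "finite (verts G)"
    using G by (simp add: is_rooted_tree_def finite_simple_graph_def)
  have sub: "branch_verts G v \<subseteq> verts G - {root_vertex G}" if "v \<in> ?N" for v
    using branch_verts_subset[OF _ that] G by (simp add: is_rooted_tree_def)
  have finB: "finite (branch_verts G v)" if "v \<in> ?N" for v
    using sub[OF that] fin by (auto intro: finite_subset)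
  have finN: "finite ?N"
    using G fin root_neighboursD(1)[of G] by (auto simp: is_rooted_tree_def intro: finite_subset)
  have one: "(\<Sum>w\<in>branch_verts G v. X ^ deg G w) =
      degree_seq_poly (branch G v) + X ^ card (root_neighbours (branch G v)) * (X - 1)"
    if v: "v \<in> ?N" for v
  proof -
    let ?H = "branch G v" and ?B = "branch_verts G v"
    have "(\<Sum>w\<in>?B. X ^ deg G w) = X ^ deg G v + (\<Sum>w\<in>?B - {v}. X ^ deg G w)"
      using finB[OF v] branch_verts_self by (rule sum.remove)
    also have "(\<Sum>w\<in>?B - {v}. X ^ deg G w) = (\<Sum>w\<in>?B - {v}. X ^ deg ?H w)"
      by (rule sum.cong) (simp_all add: deg_branch[OF G v])
    also have "\<dots> = degree_seq_poly ?H - X ^ deg ?H v"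
      using sum.remove[OF finB[OF v] branch_verts_self, of "\<lambda>w. X ^ deg ?H w"]
      by (simp add: degree_seq_poly_def)
    also have "deg G v = Suc (deg ?H v)"
      using deg_branch[OF G v branch_verts_self] by simp
    also have "deg ?H v = card (root_neighbours ?H)"
      using deg_root[OF is_rooted_tree_branch[OF G v]] by simp
    finally show ?thesis
      by (simp add: algebra_simps)
  qed
  have "degree_seq_poly G = X ^ deg G (root_vertex G) +
      (\<Sum>w\<in>(\<Union>v\<in>?N. branch_verts G v). X ^ deg G w)"
    unfolding degree_seq_poly_def
    unfolding verts_eq_root_branches[OF G]
    by (rule sum.insert) (use finN finB sub in auto)
  also have "(\<Sum>w\<in>(\<Union>v\<in>?N. branch_verts G v). X ^ deg G w) =
      (\<Sum>v\<in>?N. \<Sum>w\<in>branch_verts G v. X ^ deg G w)"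
    by (rule sum.UNION_disjoint) (use finN finB branch_verts_disjoint[OF G] in auto)
  finally show ?thesis
    by (simp only: one deg_root[OF G] cong: sum.cong)
qed

section \<open>The degree sequence polynomial is determined by the Matula number\<close>

text \<open>The defining product consists of primes, so it is its own prime factorization.\<close>

lemma prime_factorization_matula_graph:
  assumes "is_rooted_tree G"
  shows "prime_factorization (matula_graph G) =
    image_mset (\<lambda>v. nth_prime (matula_graph (branch G v))) (mset_set (root_neighbours G))"
proof -
  have "matula_graph G =
      prod_mset (image_mset (\<lambda>v. nth_prime (matula_graph (branch G v)))
        (mset_set (root_neighbours G)))"
    using assms by (simp add: matula_graph.simps[of G] prod_unfold_prod_mset)
  also have "prime_factorization \<dots> =
      image_mset (\<lambda>v. nth_prime (matula_graph (branch G v))) (mset_set (root_neighbours G))"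
    by (rule prime_factorization_prod_mset_primes) (auto simp: prime_nth_prime)
  finally show ?thesis .
qed

lemma Omega_matula_graph:
  "is_rooted_tree G \<Longrightarrow> Omega (matula_graph G) = card (root_neighbours G)"
  by (simp add: Omega_def prime_factorization_matula_graph)

lemma matula_graph_pos: "is_rooted_tree G \<Longrightarrow> 1 \<le> matula_graph G"
  using prime_gt_0_nat[OF prime_nth_prime]
  by (simp add: matula_graph.simps[of G] Suc_le_eq prod_pos)

lemma degree_seq_poly_eq_dsp_rec:
  assumes "is_rooted_tree G"
  shows "degree_seq_poly G = dsp_rec (matula_graph G)"
  using assms
proof (induction "card (verts G)" arbitrary: G rule: less_induct)
  case less
  note G = less.prems
  have "dsp_rec (matula_graph G) = X ^ card (root_neighbours G) +
      (\<Sum>v\<in>root_neighbours G.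
         dsp_rec (prime_index (nth_prime (matula_graph (branch G v)))) +
         X ^ Omega (prime_index (nth_prime (matula_graph (branch G v)))) * (X - 1))"
    by (simp add: dsp_rec.simps[of "matula_graph G"] prime_factorization_matula_graph[OF G]
        Omega_matula_graph[OF G] image_mset.compositionality o_def sum_unfold_sum_mset)
  also have "\<dots> = X ^ card (root_neighbours G) +
      (\<Sum>v\<in>root_neighbours G. degree_seq_poly (branch G v)
         + X ^ card (root_neighbours (branch G v)) * (X - 1))"
  proof (intro arg_cong2[where f = "(+)"] refl sum.cong)
    fix v assume v: "v \<in> root_neighbours G"
    note B = is_rooted_tree_branch[OF G v]
    have IH: "degree_seq_poly (branch G v) = dsp_rec (matula_graph (branch G v))"
      using less.hyps[OF _ B] card_branch_verts_less[OF G v] by simp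
    have idx: "prime_index (nth_prime (matula_graph (branch G v))) = matula_graph (branch G v)"
      using matula_graph_pos[OF B] by simp
    show "dsp_rec (prime_index (nth_prime (matula_graph (branch G v)))) =
        degree_seq_poly (branch G v)"
      using IH idx by simp
    show "X ^ Omega (prime_index (nth_prime (matula_graph (branch G v)))) * (X - 1) =
        X ^ card (root_neighbours (branch G v)) * (X - 1)"
      by (simp add: idx Omega_matula_graph[OF B])
  qed
  also have "\<dots> = degree_seq_poly G"
    by (rule degree_seq_poly_branches[OF G, symmetric])
  finally show ?case by simp
qed

section \<open>Every positive integer is a Matula number\<close>

lemma cycle_two_neighbours:
  assumes c: "is_cycle G c" and x: "x \<in> set c"
  obtains y z where "y \<in> set c" "z \<in> set c" "y \<noteq> z" "{x, y} \<in> edges G" "{x, z} \<in> edges G"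
proof -
  have c': "3 \<le> length c" "distinct c" "successively (\<lambda>u v. {u, v} \<in> edges G) c"
    "{last c, hd c} \<in> edges G"
    using c by (auto simp: is_cycle_def)
  obtain as bs where split: "c = as @ x # bs"
    using x by (meson split_list)
  \<comment> \<open>Rotating the cycle so that it starts at x makes the two neighbours the second and the
    last entry.\<close>
  define d where "d = bs @ as"
  have "2 \<le> length d" "distinct (x # d)" "set d \<subseteq> set c"
    using c' split by (auto simp: d_def)
  moreover have "{x, hd d} \<in> edges G"
  proof (cases bs)
    case Nil
    with \<open>2 \<le> length d\<close> have "as \<noteq> []" by (auto simp: d_def)
    with c'(4) split Nil show ?thesis by (simp add: d_def)
  next
    case (Cons b bs')
    with c'(3) split show ?thesis by (simp add: d_def successively_append_iff)
  qed
  moreover have "{x, last d} \<in> edges G"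
  proof (cases as rule: rev_cases)
    case Nil
    with \<open>2 \<le> length d\<close> have "bs \<noteq> []" by (auto simp: d_def)
    with c'(4) split Nil show ?thesis by (simp add: d_def insert_commute)
  next
    case (snoc as' a)
    with c'(3) split show ?thesis
      by (simp add: d_def successively_append_iff insert_commute)
  qed
  moreover have "hd d \<noteq> last d"
    using calculation(1,2) by (cases d; cases "tl d") auto
  moreover have "hd d \<in> set d" "last d \<in> set d"
    using calculation(1) by (auto intro: hd_in_set last_in_set simp: Suc_le_eq)
  ultimately show ?thesis using that[of "hd d" "last d"] by blast
qed

text \<open>A graph given by a parent map that decreases some depth is a tree: a deepest vertex of a cycle
  would have two distinct neighbours on the cycle, neither of them deeper, whereas its only such
  neighbour is its parent.\<close>

lemma is_rooted_tree_parentI: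
  fixes depth :: "'a \<Rightarrow> nat"
  assumes fin: "finite V" and r: "r \<in> V"
    and par: "\<And>v. v \<in> V \<Longrightarrow> v \<noteq> r \<Longrightarrow> par v \<in> V \<and> depth (par v) < depth v"
  shows "is_rooted_tree \<lparr>verts = V, edges = (\<lambda>v. {v, par v}) ` (V - {r}), root_vertex = r\<rparr>"
    (is "is_rooted_tree ?G")
proof -
  have simple: "finite_simple_graph ?G"
    using fin par by (fastforce simp: finite_simple_graph_def card_2_iff)
  have reach: "(r, v) \<in> (adj (edges ?G))\<^sup>*" if "v \<in> V" for v
    using that
  proof (induction "depth v" arbitrary: v rule: less_induct)
    case less
    show ?case
    proof (cases "v = r")
      case False
      with less have "(r, par v) \<in> (adj (edges ?G))\<^sup>*"
        using par by blast
      moreover have "(par v, v) \<in> adj (edges ?G)"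
        using False less.prems by (auto simp: adj_def)
      ultimately show ?thesis by (rule rtrancl.rtrancl_into_rtrancl)
    qed simp
  qed
  have connected: "is_connected ?G"
    unfolding is_connected_def
  proof (intro ballI)
    fix a b assume "a \<in> verts ?G" "b \<in> verts ?G"
    then have "(r, a) \<in> (adj (edges ?G))\<^sup>*" "(r, b) \<in> (adj (edges ?G))\<^sup>*"
      using reach by simp_all
    then show "(a, b) \<in> (adj (edges ?G))\<^sup>*"
      by (rule rtrancl_trans[OF adj_rtrancl_sym])
  qed
  have acyclic: False if c: "is_cycle ?G c" for c
  proof -
    have "c \<noteq> []" using c by (auto simp: is_cycle_def)
    then have "Max (depth ` set c) \<in> depth ` set c"
      by (intro Max_in) auto
    then obtain x where x: "x \<in> set c" "depth x = Max (depth ` set c)"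
      by auto
    then have max: "depth y \<le> depth x" if "y \<in> set c" for y
      using that by simp
    have "y = par x" if "y \<in> set c" "{x, y} \<in> edges ?G" for y
      using that(2) max[OF that(1)] par by (fastforce simp: doubleton_eq_iff)
    then show False
      using cycle_two_neighbours[OF c x(1)] by metis
  qed
  show ?thesis
    using r simple connected acyclic by (auto simp: is_rooted_tree_def)
qed

text \<open>Vertices are addresses, read from the vertex up to the root: the empty list is the root and the
  parent of \<open>xs\<close> is \<open>tl xs\<close>. With this direction, the branch at \<open>[i]\<close> consists of
  the addresses that end in \<open>i\<close>, and deleting that last entry makes it a tree of the same kind.\<close>

definition list_tree :: "nat list set \<Rightarrow> nat list rooted_graph" where
  "list_tree S = \<lparr>verts = S, edges = (\<lambda>xs. {xs, tl xs}) ` (S - {[]}), root_vertex = []\<rparr>"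

definition tree_addresses :: "nat list set \<Rightarrow> bool" where
  "tree_addresses S \<longleftrightarrow> finite S \<and> [] \<in> S \<and> (\<forall>xs\<in>S. tl xs \<in> S)"

lemma list_tree_simps [simp]:
  "verts (list_tree S) = S"
  "edges (list_tree S) = (\<lambda>xs. {xs, tl xs}) ` (S - {[]})"
  "root_vertex (list_tree S) = []"
  by (simp_all add: list_tree_def)

lemma is_rooted_tree_list_tree: "tree_addresses S \<Longrightarrow> is_rooted_tree (list_tree S)"
  unfolding list_tree_def tree_addresses_def
  by (rule is_rooted_tree_parentI[where depth = length]) auto

lemma root_neighbours_list_tree:
  "root_neighbours (list_tree S) = {[i] | i. [i] \<in> S}"
proof -
  have "{[], v} \<in> (\<lambda>xs. {xs, tl xs}) ` (S - {[]}) \<longleftrightarrow> v \<in> S \<and> v \<noteq> [] \<and> tl v = []" for v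
    by (cases v) (auto simp: doubleton_eq_iff image_iff intro: bexI[of _ v])
  moreover have "v \<noteq> [] \<and> tl v = [] \<longleftrightarrow> (\<exists>i. v = [i])" for v :: "nat list"
    by (cases v) auto
  ultimately have "root_neighbours (list_tree S) = {v. v \<in> S \<and> (\<exists>i. v = [i])}"
    unfolding root_neighbours_def list_tree_simps by (simp only:)
  then show ?thesis by auto
qed

lemma branch_verts_list_tree:
  assumes S: "tree_addresses S" and i: "[i] \<in> S"
  shows "branch_verts (list_tree S) [i] = {xs @ [i] | xs. xs @ [i] \<in> S}"
proof
  let ?R = "adj {e \<in> edges (list_tree S). root_vertex (list_tree S) \<notin> e}"
  show "branch_verts (list_tree S) [i] \<subseteq> {xs @ [i] | xs. xs @ [i] \<in> S}"
  proof
    fix w assume "w \<in> branch_verts (list_tree S) [i]"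
    then have "([i], w) \<in> ?R\<^sup>*" by (simp add: branch_verts_def)
    then show "w \<in> {xs @ [i] | xs. xs @ [i] \<in> S}"
    proof (induction rule: rtrancl_induct)
      case base
      show ?case using i by auto
    next
      case (step y z)
      then obtain xs where xs: "y = xs @ [i]" by auto
      have z: "z \<in> S" "z \<noteq> []" "z = tl y \<or> y = tl z"
        using step.hyps S by (auto simp: adj_def doubleton_eq_iff tree_addresses_def)
      from z(3) have "\<exists>ys. z = ys @ [i]"
      proof
        assume "z = tl y"
        with z(2) xs have "z = tl xs @ [i]" by (cases xs) auto
        then show ?thesis ..
      next
        assume "y = tl z"
        with z(2) xs have "z = (hd z # xs) @ [i]" by (cases z) auto
        then show ?thesis ..
      qed
      with z(1) show ?case by blast
    qed
  qed
  show "{xs @ [i] | xs. xs @ [i] \<in> S} \<subseteq> branch_verts (list_tree S) [i]"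
  proof -
    have "([i], xs @ [i]) \<in> ?R\<^sup>*" if "xs @ [i] \<in> S" for xs
      using that
    proof (induction xs)
      case (Cons x xs)
      then have "xs @ [i] \<in> S"
        using S unfolding tree_addresses_def by (metis append_Cons list.sel(3))
      then have "([i], xs @ [i]) \<in> ?R\<^sup>*"
        using Cons.IH by simp
      moreover have "(xs @ [i], (x # xs) @ [i]) \<in> ?R"
        using Cons.prems by (auto simp: adj_def image_iff intro!: bexI[of _ "x # xs @ [i]"])
      ultimately show ?case by (rule rtrancl.rtrancl_into_rtrancl)
    qed simp
    then show ?thesis by (auto simp: branch_verts_def)
  qed
qed

lemma iso_map_branch_list_tree:
  assumes S: "tree_addresses S" and i: "[i] \<in> S"
  shows "iso_map (\<lambda>xs. xs @ [i]) (list_tree {xs. xs @ [i] \<in> S}) (branch (list_tree S) [i])"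
proof -
  let ?B = "{xs @ [i] | xs. xs @ [i] \<in> S}"
  let ?T = "{xs. xs @ [i] \<in> S}"
  have "{e \<in> edges (list_tree S). e \<subseteq> ?B} =
      (\<lambda>e. (\<lambda>xs. xs @ [i]) ` e) ` edges (list_tree ?T)" (is "?L = ?E")
  proof
    show "?L \<subseteq> ?E"
    proof
      fix e assume "e \<in> ?L"
      then have "e \<in> (\<lambda>xs. {xs, tl xs}) ` (S - {[]})" and eB: "e \<subseteq> ?B"
        by simp_all
      then obtain ys where ys: "ys \<in> S" "ys \<noteq> []" "e = {ys, tl ys}"
        by blast
      moreover obtain zs where zs: "tl ys = zs @ [i]"
        using eB ys(3) by blast
      moreover obtain xs where xs: "ys = xs @ [i]"
        using eB ys(3) by blast
      ultimately have "xs \<noteq> []" by auto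
      then have "e = (\<lambda>xs. xs @ [i]) ` {xs, tl xs}"
        using ys xs by simp
      moreover have "{xs, tl xs} \<in> edges (list_tree ?T)"
        using ys xs \<open>xs \<noteq> []\<close> by auto
      ultimately show "e \<in> ?E"
        by (rule image_eqI)
    qed
    show "?E \<subseteq> ?L"
    proof
      fix e assume "e \<in> ?E"
      then obtain xs where xs: "xs @ [i] \<in> S" "xs \<noteq> []" "e = {xs @ [i], tl xs @ [i]}"
        by auto
      then have "tl xs @ [i] = tl (xs @ [i])" by simp
      moreover from this have "tl xs @ [i] \<in> S"
        using xs S by (metis tree_addresses_def)
      ultimately show "e \<in> ?L"
        using xs by (auto intro!: image_eqI)
    qed
  qed
  moreover have "bij_betw (\<lambda>xs. xs @ [i]) ?T ?B"
    by (auto simp: bij_betw_def inj_on_def)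
  ultimately show ?thesis
    by (simp add: iso_map_def branch_verts_list_tree[OF S i])
qed

lemma tree_addresses_branch:
  assumes "tree_addresses S" "[i] \<in> S"
  shows "tree_addresses {xs. xs @ [i] \<in> S}"
proof -
  have "finite ((\<lambda>xs. xs @ [i]) -` S)"
    using assms by (intro finite_vimageI) (auto simp: tree_addresses_def inj_def)
  moreover have "tl xs @ [i] \<in> S" if "xs @ [i] \<in> S" for xs
    using that assms by (cases xs) (force simp: tree_addresses_def)+
  ultimately show ?thesis
    using assms by (auto simp: tree_addresses_def vimage_def)
qed

lemma matula_list_tree:
  assumes S: "tree_addresses S"
  shows "matula_graph (list_tree S) =
    (\<Prod>i | [i] \<in> S. nth_prime (matula_graph (list_tree {xs. xs @ [i] \<in> S})))"
proof -
  have "matula_graph (list_tree S) =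
      (\<Prod>v\<in>(\<lambda>i. [i]) ` {i. [i] \<in> S}. nth_prime (matula_graph (branch (list_tree S) v)))"
    by (simp add: matula_graph.simps[of "list_tree S"] is_rooted_tree_list_tree[OF S]
        root_neighbours_list_tree image_def) (simp add: Collect_conj_eq conj_commute)
  also have "\<dots> = (\<Prod>i | [i] \<in> S. nth_prime (matula_graph (branch (list_tree S) [i])))"
    by (subst prod.reindex) (auto simp: inj_on_def)
  also have "\<dots> = (\<Prod>i | [i] \<in> S. nth_prime (matula_graph (list_tree {xs. xs @ [i] \<in> S})))"
  proof (rule prod.cong)
    fix i assume "i \<in> {i. [i] \<in> S}"
    then have i: "[i] \<in> S" by simp
    have "is_rooted_tree (branch (list_tree S) [i])"
      using i by (intro is_rooted_tree_branch is_rooted_tree_list_tree[OF S])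
        (simp add: root_neighbours_list_tree)
    then show "nth_prime (matula_graph (branch (list_tree S) [i])) =
        nth_prime (matula_graph (list_tree {xs. xs @ [i] \<in> S}))"
      using matula_graph_iso[OF iso_map_branch_list_tree[OF S i]]
        is_rooted_tree_list_tree[OF tree_addresses_branch[OF S i]] by simp
  qed simp
  finally show ?thesis .
qed

lemma prod_nth_eq_prod_list: "(\<Prod>i<length xs. xs ! i) = prod_list xs"
  by (induction xs) (simp_all add: prod.lessThan_Suc_shift del: prod.lessThan_Suc)

text \<open>By strong induction, every prime factor of \<open>n\<close> has an index below \<open>n\<close> and so is
  contributed by some branch; these branches are hung below a new root. Branches are numbered by
  positions in a list of the prime factors, so that repeated factors yield separate copies.\<close>

lemma ex_list_tree_matula:
  assumes "1 \<le> n"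
  shows "\<exists>S. tree_addresses S \<and> matula_graph (list_tree S) = n"
  using assms
proof (induction n rule: less_induct)
  case (less n)
  obtain ps where ps: "mset ps = prime_factorization n"
    using ex_mset by blast
  have "\<exists>S. tree_addresses S \<and> nth_prime (matula_graph (list_tree S)) = p"
    if "p \<in> set ps" for p
  proof -
    have p: "p \<in># prime_factorization n" using that ps by (metis set_mset_mset)
    then have "prime p" by auto
    then obtain t where "1 \<le> t" "p = nth_prime t" "prime_index p = t"
      by (rule prime_indexE)
    moreover from this have "t < n" using prime_index_less[OF p] by simp
    ultimately show ?thesis using less.IH[of t] by auto
  qed
  then obtain T where T: "\<And>p. p \<in> set ps \<Longrightarrow> tree_addresses (T p)"
    "\<And>p. p \<in> set ps \<Longrightarrow> nth_prime (matula_graph (list_tree (T p))) = p"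
    by metis
  let ?k = "length ps"
  define S where "S = insert [] (\<Union>i<?k. (\<lambda>xs. xs @ [i]) ` T (ps ! i))"
  have branch: "{xs. xs @ [i] \<in> S} = T (ps ! i)" if "i < ?k" for i
    using that by (auto simp: S_def)
  have heads: "{i. [i] \<in> S} = {..<?k}"
    using T(1)[OF nth_mem] by (auto simp: S_def tree_addresses_def)
  have S: "tree_addresses S"
    unfolding tree_addresses_def
  proof (intro conjI ballI)
    show "finite S" "[] \<in> S"
      using T(1)[OF nth_mem] by (auto simp: S_def tree_addresses_def)
    fix ys assume "ys \<in> S"
    then consider "ys = []" | i xs where "i < ?k" "xs \<in> T (ps ! i)" "ys = xs @ [i]"
      by (auto simp: S_def)
    then show "tl ys \<in> S"
    proof cases
      case 2
      then have "tl xs \<in> T (ps ! i)"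
        using T(1)[OF nth_mem] by (auto simp: tree_addresses_def)
      with 2 show ?thesis
        by (cases xs) (auto simp: S_def)
    qed (simp add: S_def)
  qed
  have "matula_graph (list_tree S) = (\<Prod>i<?k. ps ! i)"
    unfolding matula_list_tree[OF S] heads
    by (rule prod.cong) (simp_all add: branch T(2))
  also have "\<dots> = prod_mset (mset ps)"
    by (simp add: prod_mset_prod_list prod_nth_eq_prod_list)
  also have "\<dots> = n"
    using less.prems by (simp add: ps prod_mset_prime_factorization_nat)
  finally show ?case using S by blast
qed

text \<open>Isomorphism classes are represented by trees on natural numbers, so the addresses are encoded;
  the encoded parent map shows that the result is again a tree.\<close>

lemma ex_nat_tree_matula:
  assumes "1 \<le> n"
  shows "\<exists>G :: nat rooted_graph. is_rooted_tree G \<and> matula_graph G = n"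
proof -
  obtain S where S: "tree_addresses S" "matula_graph (list_tree S) = n"
    using ex_list_tree_matula[OF assms] by blast
  let ?par = "\<lambda>v. to_nat (tl (from_nat v :: nat list))"
  let ?H = "\<lparr>verts = to_nat ` S, edges = (\<lambda>v. {v, ?par v}) ` (to_nat ` S - {to_nat ([] :: nat list)}),
    root_vertex = to_nat ([] :: nat list)\<rparr>"
  have H: "is_rooted_tree ?H"
    using S(1)
    by (intro is_rooted_tree_parentI[where depth = "\<lambda>v. length (from_nat v :: nat list)"])
      (auto simp: tree_addresses_def)
  have "iso_map to_nat (list_tree S) ?H"
  proof -
    have "to_nat ` S - {to_nat ([] :: nat list)} = to_nat ` (S - {[]})"
      by auto
    then show ?thesis
      by (simp add: iso_map_def image_image inj_on_imp_bij_betw)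
  qed
  then have "matula_graph ?H = n"
    using matula_graph_iso[OF _ is_rooted_tree_list_tree[OF S(1)] H] S(2) by simp
  with H show ?thesis by blast
qed

section \<open>The recursion for the degree sequence polynomial\<close>

text \<open>Surjectivity makes \<open>tau n\<close> a tree with Matula number \<open>n\<close>, and the polynomial of
  such a tree depends only on \<open>n\<close>.\<close>

lemma DSP_eq_dsp_rec:
  assumes "1 \<le> n"
  shows "DSP n = dsp_rec n"
proof -
  have "\<exists>T. matula T = n"
    using ex_nat_tree_matula[OF assms]
    by transfer (auto intro: tree_iso_refl)
  then have "matula (tau n) = n"
    unfolding tau_def by (metis f_inv_into_f rangeI)
  moreover have "tree_dsp T = dsp_rec (matula T)" for T
    by transfer (simp add: tree_iso_def degree_seq_poly_eq_dsp_rec)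
  ultimately show ?thesis by (simp add: DSP_def)
qed

theorem proposition3p27:
  fixes n :: nat
  assumes "n \<ge> 1"
  shows "(n = 1 \<longrightarrow> DSP n = 1) \<and>
    (\<forall>t\<ge>1. n = nth_prime t \<longrightarrow> DSP n = DSP t + X ^ Omega t * (X - 1) + X) \<and>
    (\<forall>r\<ge>2. \<forall>s\<ge>2. n = r * s \<longrightarrow>
       DSP n = DSP r + DSP s - X ^ Omega r - X ^ Omega s + X ^ Omega n)"
  using assms dsp_rec_1 dsp_rec_nth_prime dsp_rec_mult
  by (auto simp: DSP_eq_dsp_rec)

end
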